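(* Let $r\ge 0$ be an integer, $\mu_r\in\mathbb{R}$, and $k\ge r+1$. Let $\xi^{(k)}_1$ and $\xi^{(k)}_k$ be the smallest and the greatest zeros of $P_k$, and let ${\xi^t}^{(k)}_1,\dots,{\xi^t}^{(k)}_k$ be the zeros of $P^t_k(\mu_r;r)$ in increasing order. Then: \begin{enumerate} \item $\operatorname{sgn}\big[P^t_k(\mu_r;r)(\xi^{(k)}_k)\big]=-\operatorname{sgn}(\mu_r)$. \item $\operatorname{sgn}\big[P^t_k(\mu_r;r)(\xi^{(k)}_1)\big]=(-1)^k\operatorname{sgn}(\mu_r)$. \item If $\mu_r>0$, then: (a) there exists $i$, $1\le i\le k$, such that ${\xi^t}^{(k)}_i>\xi^{(k)}_k$ (with $P^t_k(\mu_r;r)({\xi^t}^{(k)}_i)=0$); (b) the number of zeros of $P^t_k(\mu_r;r)$ greater than $\xi^{(k)}_k$ is odd; (c) $(-1)^kP^t_k(\mu_r;r)(x)>0$ for all real $x\le\xi^{(k)}_1$; (d) there are no zeros of $P^t_k(\mu_r;r)$ less than $\xi^{(k)}_1$. \item If $\mu_r<0$, then: (a) $P^t_k(\mu_r;r)(y)>0$ for all real $y\ge\xi^{(k)}_k$; (b) there are no zeros of $P^t_k(\mu_r;r)$ greater than $\xi^{(k)}_k$; (c) there exists $i$, $1\le i\le k$, such that ${\xi^t}^{(k)}_i<\xi^{(k)}_1$ (with $P^t_k(\mu_r;r)({\xi^t}^{(k)}_i)=0$); (d) the number of zeros of $P^t_k(\mu_r;r)$ less than $\xi^{(k)}_1$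 is odd. \end{enumerate}
   Context: $\{P_n\}_{n\ge0}$ denotes the monic Chebyshev polynomials of the second kind: $P_0=1$, $P_1=x$, $P_{n+2}(x)=xP_{n+1}(x)-\frac14P_n(x)$ for $n\ge 0$; the zeros of $P_n$ are real and simple. For an integer $r\ge 0$ and $\mu_r\in\mathbb{R}$, the $r$th-perturbed sequence by translation $\{P^t_n(\mu_r;r)\}_{n\ge 0}$ is the monic sequence with $P^t_0=1$, $P^t_1(x)=x-\beta_0$, $P^t_{n+2}(x)=(x-\beta_{n+1})P^t_{n+1}(x)-\frac14P^t_n(x)$ for $n\ge 0$, where $\beta_r=\mu_r$ and $\beta_n=0$ for $n\ne r$; its zeros are real and simple (positive definite case). $\operatorname{sgn}$ is the sign function, with $\operatorname{sgn}(0)=0$. *)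

theory Defs
  imports Complex_Main "HOL-Computational_Algebra.Polynomial"
begin

text \<open>\<open>cheb n\<close> is the monic polynomial \<open>U\<^sub>n(x) / 2^n\<close>, with \<open>U\<^sub>n\<close> the Chebyshev polynomial of the
  second kind.\<close>

fun cheb :: "nat \<Rightarrow> real poly" where
  "cheb 0 = 1"
| "cheb (Suc 0) = [:0, 1:]"
| "cheb (Suc (Suc n)) = [:0, 1:] * cheb (Suc n) - smult (1/4) (cheb n)"

definition pert_beta :: "real \<Rightarrow> nat \<Rightarrow> nat \<Rightarrow> real" where
  "pert_beta \<mu> r n = (if n = r then \<mu> else 0)"

text \<open>\<open>cheb_trans \<mu> r n\<close> is the perturbation by translation $P^t_n(\mu; r)$ of \<open>cheb n\<close>: only the
  recurrence coefficient \<open>\<beta>\<^sub>r\<close> is changed, from \<open>0\<close> to \<open>\<mu>\<close>.\<close>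

fun cheb_trans :: "real \<Rightarrow> nat \<Rightarrow> nat \<Rightarrow> real poly" where
  "cheb_trans \<mu> r 0 = 1"
| "cheb_trans \<mu> r (Suc 0) = [:- pert_beta \<mu> r 0, 1:]"
| "cheb_trans \<mu> r (Suc (Suc n)) =
     [:- pert_beta \<mu> r (Suc n), 1:] * cheb_trans \<mu> r (Suc n) - smult (1/4) (cheb_trans \<mu> r n)"

definition zeros :: "real poly \<Rightarrow> real set" where
  "zeros p = {x. poly p x = 0}"

text \<open>The \<open>i\<close>-th zero in increasing order, counted from \<open>i = 1\<close>. Meaningful for
  \<open>1 \<le> i \<le> card (zeros p)\<close>. Zeros are not repeated according to multiplicity: all zeros
  of the polynomials above are simple.\<close>

definition nth_zero :: "real poly \<Rightarrow> nat \<Rightarrow> real" where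
  "nth_zero p i = sorted_list_of_set (zeros p) ! (i - 1)"

end

theory Submission
  imports Defs
begin

text \<open>With \<open>s = k - r - 1\<close>, the perturbed polynomial is \<open>P\<^sub>k - \<mu> P\<^sub>r P\<^sub>s\<close>. All \<open>P\<^sub>j\<close> with \<open>j < k\<close> are
  positive on \<open>[c, \<infinity>)\<close>, where \<open>c = cos (\<pi> / (k + 1))\<close> is the greatest zero of \<open>P\<^sub>k\<close>; this settles
  the signs. Moreover \<open>P\<^sub>k / (P\<^sub>r P\<^sub>s) = h\<^sub>r + h\<^sub>s - x\<close> with \<open>h\<^sub>n = P\<^bsub>n+1\<^esub> / P\<^sub>n\<close>. Since
  \<open>h\<^bsub>n+1\<^esub> = x - 1 / (4 h\<^sub>n)\<close>, each \<open>h\<^sub>n\<close> grows at least as fast as \<open>x\<close>, so the quotient takes the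
  value \<open>\<mu> > 0\<close> exactly once on \<open>(c, \<infinity>)\<close>: the odd number of zeros is in fact 1. The claims about
  the smallest zero follow by the symmetry \<open>x \<mapsto> -x\<close>, \<open>\<mu> \<mapsto> -\<mu>\<close>.\<close>

section \<open>Expansion of the perturbed polynomials in Chebyshev polynomials\<close>

lemma cheb_trans_eq_cheb: "n \<le> r \<Longrightarrow> cheb_trans \<mu> r n = cheb n"
  by (induction n rule: cheb.induct) (auto simp: pert_beta_def)

lemma cheb_trans_Suc: "cheb_trans \<mu> r (Suc r) = cheb (Suc r) - smult \<mu> (cheb r)"
proof (cases r)
  case (Suc m)
  have "[:- \<mu>, 1:] = [:0, 1:] - [:\<mu>:]" by simp
  then show ?thesis
    using Suc by (simp add: cheb_trans_eq_cheb pert_beta_def algebra_simps)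
qed (simp add: pert_beta_def)

text \<open>Past index \<open>r + 1\<close> the perturbed recurrence is the Chebyshev one, so in
  \<open>n\<close> both sides obey the same three-term recurrence; the cases \<open>n = 0\<close>
  and \<open>n = 1\<close> start it.\<close>

lemma cheb_trans_conv_cheb:
  "cheb_trans \<mu> r (Suc (r + n)) = cheb (Suc (r + n)) - smult \<mu> (cheb r * cheb n)"
proof (induction n rule: cheb.induct)
  case 2
  then show ?case
    by (simp add: cheb_trans_Suc cheb_trans_eq_cheb pert_beta_def algebra_simps)
next
  case (3 n)
  have "cheb_trans \<mu> r (Suc (r + Suc (Suc n))) =
      [:0, 1:] * cheb_trans \<mu> r (Suc (r + Suc n)) - smult (1/4) (cheb_trans \<mu> r (Suc (r + n)))"
    by (simp add: pert_beta_def)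
  then show ?case
    unfolding 3 by (simp add: poly_eq_poly_eq_iff[symmetric] fun_eq_iff algebra_simps)
qed (simp add: cheb_trans_Suc)

section \<open>Degree, reflection and indexing of zeros\<close>

lemma degree_lead_coeff_cheb_trans:
  "degree (cheb_trans \<mu> r n) = n \<and> lead_coeff (cheb_trans \<mu> r n) = 1"
proof (induction n rule: cheb.induct)
  case (3 n)
  define p q where "p = [:- pert_beta \<mu> r (Suc n), 1:] * cheb_trans \<mu> r (Suc n)"
    and "q = smult (1/4) (cheb_trans \<mu> r n)"
  have nz: "cheb_trans \<mu> r (Suc n) \<noteq> 0" using 3 by force
  have dp: "degree p = Suc (Suc n)" unfolding p_def using 3 nz by (subst degree_mult_eq) auto
  have dq: "degree (- q) < degree p" using 3 dp by (simp add: q_def)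
  have "lead_coeff p = 1"
  proof -
    have "coeff (cheb_trans \<mu> r (Suc n)) (Suc n) = 1" using 3(1) by metis
    then show ?thesis unfolding p_def lead_coeff_mult using 3 by simp
  qed
  moreover have "degree (p + - q) = degree p" using dq by (rule degree_add_eq_left)
  moreover have "cheb_trans \<mu> r (Suc (Suc n)) = p + - q" by (simp add: p_def q_def)
  ultimately show ?case using dp dq by (simp add: coeff_eq_0)
qed auto

lemma degree_cheb_trans: "degree (cheb_trans \<mu> r n) = n"
  using degree_lead_coeff_cheb_trans by blast

lemma cheb_trans_nonzero: "cheb_trans \<mu> r n \<noteq> 0"
  using degree_lead_coeff_cheb_trans[of \<mu> r n] by force

lemma cheb_trans_0: "cheb_trans 0 r n = cheb n"
  by (induction n rule: cheb.induct) (auto simp: pert_beta_def)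

lemma cheb_trans_minus:
  "poly (cheb_trans \<mu> r n) (- x) = (-1) ^ n * poly (cheb_trans (- \<mu>) r n) x"
  by (induction n rule: cheb.induct) (auto simp: pert_beta_def algebra_simps)

lemma cheb_minus: "poly (cheb n) (- x) = (-1) ^ n * poly (cheb n) x"
  using cheb_trans_minus[of 0 0 n x] by (simp add: cheb_trans_0)

lemma finite_zeros: "p \<noteq> 0 \<Longrightarrow> finite (zeros p)"
  by (simp add: zeros_def poly_roots_finite)

lemma nth_zero_exists:
  assumes "p \<noteq> 0" "poly p z = 0"
  obtains i where "1 \<le> i" "i \<le> degree p" "nth_zero p i = z"
proof -
  let ?l = "sorted_list_of_set (zeros p)"
  have fin: "finite (zeros p)" using assms by (simp add: finite_zeros)
  then have "z \<in> set ?l" using assms by (simp add: zeros_def)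
  then obtain j where j: "j < length ?l" "?l ! j = z" by (auto simp: in_set_conv_nth)
  \<comment> \<open>The list has one entry per distinct root, and there are at most
    \<open>degree p\<close> of these.\<close>
  have "length ?l \<le> degree p"
    using fin assms by (simp add: zeros_def card_poly_roots_bound)
  \<comment> \<open>List positions start at 0, zeros are counted from 1.\<close>
  then show thesis using that[of "Suc j"] j by (simp add: nth_zero_def)
qed

section \<open>Trigonometric form, positivity and extreme zeros\<close>

lemma cheb_cos: "poly (cheb n) (cos \<theta>) * sin \<theta> * 2 ^ n = sin (real (Suc n) * \<theta>)"
proof (induction n rule: cheb.induct)
  case 2
  then show ?case by (simp add: sin_double)
next
  case (3 n)
  \<comment> \<open>This is the recurrence of \<open>cheb\<close> after scaling by
    \<open>2 ^ n\<close>.\<close>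
  have "sin (real (Suc (Suc (Suc n))) * \<theta>) + sin (real (Suc n) * \<theta>)
      = 2 * cos \<theta> * sin (real (Suc (Suc n)) * \<theta>)"
  proof -
    have "real (Suc (Suc (Suc n))) * \<theta> = real (Suc (Suc n)) * \<theta> + \<theta>"
      "real (Suc n) * \<theta> = real (Suc (Suc n)) * \<theta> - \<theta>"
      by (simp_all add: algebra_simps)
    then show ?thesis by (simp only: sin_add sin_diff) simp
  qed
  moreover have "poly (cheb (Suc (Suc n))) (cos \<theta>) * sin \<theta> * 2 ^ Suc (Suc n)
      = 2 * cos \<theta> * (poly (cheb (Suc n)) (cos \<theta>) * sin \<theta> * 2 ^ Suc n)
        - poly (cheb n) (cos \<theta>) * sin \<theta> * 2 ^ n"
    by (simp add: algebra_simps)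
  ultimately show ?case unfolding 3 by linarith
qed simp

text \<open>Covers the range where \<open>x = cos \<theta>\<close> is of no use. Positivity alone is
  not inductive; the ratio bound 1/2 is, being the fixed point of
  \<open>h = 1 - 1 / (4 * h)\<close>.\<close>

lemma cheb_ge_1:
  assumes "x \<ge> 1"
  shows "poly (cheb n) x > 0 \<and> poly (cheb (Suc n)) x \<ge> poly (cheb n) x / 2"
proof (induction n)
  case 0
  then show ?case using assms by simp
next
  case (Suc n)
  then have pos: "poly (cheb (Suc n)) x > 0" by simp
  then have "x * poly (cheb (Suc n)) x \<ge> poly (cheb (Suc n)) x"
    using assms by simp
  moreover have "poly (cheb (Suc (Suc n))) x = x * poly (cheb (Suc n)) x - poly (cheb n) x / 4"
    by simp
  ultimately show ?case using Suc pos by linarith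
qed

text \<open>For \<open>x = cos \<theta> < 1\<close> the hypotheses keep
  \<open>(j + 1) * \<theta>\<close> strictly between 0 and \<open>pi\<close>, where the sine is
  positive. The last one excludes the endpoint for \<open>j = k\<close>, as \<open>cheb k\<close>
  vanishes there.\<close>

lemma cheb_pos:
  assumes "k \<ge> 1" "j \<le> k" "x \<ge> cos (pi / real (Suc k))" "j < k \<or> x > cos (pi / real (Suc k))"
  shows "poly (cheb j) x > 0"
proof (cases "x \<ge> 1")
  case True
  then show ?thesis using cheb_ge_1 by blast
next
  case False
  let ?t = "pi / real (Suc k)"
  have t: "0 < ?t" by simp
  \<comment> \<open>From \<open>k \<ge> 1\<close>; hence \<open>x\<close> lies in [0, 1) and
    \<open>arccos\<close> inverts \<open>cos\<close> there.\<close>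
  have t2: "?t \<le> pi / 2" using assms by (intro divide_left_mono) auto
  have c: "0 \<le> cos ?t" using t t2 by (intro cos_ge_zero) linarith+
  define \<theta> where "\<theta> = arccos x"
  have x: "x = cos \<theta>" using False assms c by (simp add: \<theta>_def)
  have th0: "0 < \<theta>" "\<theta> \<le> pi"
    using False assms c arccos_lt_bounded[of x] by (simp_all add: \<theta>_def)
  have le: "\<theta> \<le> ?t"
    using cos_monotone_0_pi[of ?t \<theta>] assms(3) th0 t x by linarith
  have "real (Suc j) * \<theta> < pi"
  proof (cases "j < k")
    case True
    have "real (Suc j) * \<theta> < real (Suc k) * \<theta>" using True th0 by simp
    also have "\<dots> \<le> pi" using le by (simp add: field_simps)
    finally show ?thesis .
  next
    case False
    then have "\<theta> < ?t" using assms le x by (cases "\<theta> = ?t") auto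
    then have "real (Suc k) * \<theta> < pi" by (simp add: field_simps)
    then show ?thesis using False assms by simp
  qed
  then have "sin (real (Suc j) * \<theta>) > 0" using th0 by (intro sin_gt_zero) auto
  moreover have "sin \<theta> > 0"
    using th0 le t2 pi_gt_zero by (intro sin_gt_zero) linarith+
  ultimately show ?thesis
    using cheb_cos[of j \<theta>] x by (metis zero_less_mult_pos2 zero_less_power zero_less_numeral)
qed

lemma cheb_root:
  assumes "k \<ge> 1"
  shows "poly (cheb k) (cos (pi / real (Suc k))) = 0"
proof -
  have "pi / real (Suc k) < pi" using assms by (simp add: field_simps)
  then have "sin (pi / real (Suc k)) > 0" by (intro sin_gt_zero) auto
  then show ?thesis using cheb_cos[of k "pi / real (Suc k)"] by simp
qed

lemma Max_zeros_cheb: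
  assumes "k \<ge> 1"
  shows "Max (zeros (cheb k)) = cos (pi / real (Suc k))"
proof (rule Max_eqI)
  show "finite (zeros (cheb k))"
    using cheb_trans_nonzero[of 0 0 k] by (simp add: cheb_trans_0 finite_zeros)
  show "y \<le> cos (pi / real (Suc k))" if "y \<in> zeros (cheb k)" for y
    using that cheb_pos[OF assms, of k y] by (force simp: zeros_def)
qed (use cheb_root[OF assms] in \<open>simp add: zeros_def\<close>)

lemma Min_zeros_cheb:
  assumes "k \<ge> 1"
  shows "Min (zeros (cheb k)) = - cos (pi / real (Suc k))"
proof (rule Min_eqI)
  show "finite (zeros (cheb k))"
    using cheb_trans_nonzero[of 0 0 k] by (simp add: cheb_trans_0 finite_zeros)
  show "- cos (pi / real (Suc k)) \<le> y" if "y \<in> zeros (cheb k)" for y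
    using that cheb_pos[OF assms, of k "- y"] cheb_minus[of k y] by (force simp: zeros_def)
qed (use cheb_root[OF assms] in \<open>simp add: zeros_def cheb_minus\<close>)

section \<open>Growth of the ratios and the single zero beyond the greatest zero\<close>

lemma cheb_add:
  "cheb (Suc (r + s)) + [:0, 1:] * cheb r * cheb s = cheb (Suc r) * cheb s + cheb r * cheb (Suc s)"
proof (induction s arbitrary: r)
  case (Suc s)
  \<comment> \<open>Passing from \<open>r\<close> to \<open>Suc r\<close> and from
    \<open>Suc s\<close> to \<open>s\<close> keeps the index sum, so the first term on the left is
    unchanged; the recurrence accounts for the rest.\<close>
  show ?case using Suc[of "Suc r"]
    by (simp add: poly_eq_poly_eq_iff[symmetric] fun_eq_iff algebra_simps)
qed simp

lemma cheb_ratio_expanding: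
  assumes "x \<le> y" "\<And>j. j \<le> n \<Longrightarrow> poly (cheb j) x > 0 \<and> poly (cheb j) y > 0"
  shows "poly (cheb (Suc n)) y / poly (cheb n) y - poly (cheb (Suc n)) x / poly (cheb n) x \<ge> y - x"
  using assms(2)
proof (induction n)
  case (Suc n)
  define h where "h t = poly (cheb (Suc n)) t / poly (cheb n) t" for t
  have pos: "poly (cheb n) x > 0" "poly (cheb n) y > 0"
    "poly (cheb (Suc n)) x > 0" "poly (cheb (Suc n)) y > 0"
    using Suc.prems[of n] Suc.prems[of "Suc n"] by auto
  have step: "poly (cheb (Suc (Suc n))) t / poly (cheb (Suc n)) t = t - 1 / (4 * h t)"
    if "poly (cheb n) t > 0" "poly (cheb (Suc n)) t > 0" for t
    using that by (simp add: h_def field_simps)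
  have "h y - h x \<ge> y - x" unfolding h_def using Suc by simp
  \<comment> \<open>Monotonicity of \<open>h\<close> suffices: in \<open>t - 1 / (4 * h t)\<close>
    the term \<open>t\<close> already supplies slope 1.\<close>
  then have "h x \<le> h y" using assms(1) by simp
  moreover have "h x > 0" using pos by (simp add: h_def)
  ultimately have "1 / (4 * h y) \<le> 1 / (4 * h x)" by (intro divide_left_mono) auto
  then show ?case using step pos by simp
qed simp

lemma cheb_trans_root_gt:
  assumes "\<mu> > 0" "k \<ge> r + 1"
  shows "\<exists>!z. z > cos (pi / real (Suc k)) \<and> poly (cheb_trans \<mu> r k) z = 0"
proof -
  let ?c = "cos (pi / real (Suc k))"
  define s where "s = k - r - 1"
  have k: "k = Suc (r + s)" using assms s_def by simp
  let ?P = "poly (cheb_trans \<mu> r k)"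
  \<comment> \<open>On \<open>t \<ge> ?c\<close> this is the perturbed polynomial divided by
    \<open>cheb r * cheb s\<close>, hence of the same sign.\<close>
  define F where "F t = poly (cheb (Suc r)) t / poly (cheb r) t
    + poly (cheb (Suc s)) t / poly (cheb s) t - t - \<mu>" for t
  have pos: "poly (cheb j) t > 0" if "t \<ge> ?c" "j < k" for t j
    using cheb_pos[of k j t] that k by auto
  have P: "?P t = poly (cheb r) t * poly (cheb s) t * F t" if "t \<ge> ?c" for t
  proof -
    have "poly (cheb k) t + t * poly (cheb r) t * poly (cheb s) t
        = poly (cheb (Suc r)) t * poly (cheb s) t + poly (cheb r) t * poly (cheb (Suc s)) t"
      using arg_cong[OF cheb_add[of r s], of "\<lambda>p. poly p t"] k by simp
    moreover have "?P t = poly (cheb k) t - \<mu> * (poly (cheb r) t * poly (cheb s) t)"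
      using cheb_trans_conv_cheb[of \<mu> r s] k by simp
    moreover have "poly (cheb r) t > 0" "poly (cheb s) t > 0" using pos[OF that] k by auto
    moreover from this have "poly (cheb r) t * poly (cheb s) t * F t
        = poly (cheb (Suc r)) t * poly (cheb s) t + poly (cheb r) t * poly (cheb (Suc s)) t
          - t * poly (cheb r) t * poly (cheb s) t - \<mu> * (poly (cheb r) t * poly (cheb s) t)"
      by (simp add: F_def field_simps del: cheb.simps)
    ultimately show ?thesis by linarith
  qed
  \<comment> \<open>Two ratios of slope at least 1, minus \<open>t\<close>, leave slope at least
    1.\<close>
  have expanding: "F y - F x \<ge> y - x" if "?c \<le> x" "x \<le> y" for x y
    using cheb_ratio_expanding[of x y r] cheb_ratio_expanding[of x y s] pos that k
    by (simp add: F_def)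
  have zero: "?P t = 0 \<longleftrightarrow> F t = 0" if "t \<ge> ?c" for t
    using P[OF that] pos[OF that, of r] pos[OF that, of s] k by simp
  \<comment> \<open>As \<open>cheb k\<close> vanishes at \<open>?c\<close>, only
    \<open>- \<mu> * cheb r * cheb s\<close> remains.\<close>
  have Pc: "?P ?c < 0"
    using cheb_trans_conv_cheb[of \<mu> r s] cheb_root[of k] pos[of ?c r] pos[of ?c s] k assms
    by simp
  have "F ?c < 0"
    using P[of ?c] Pc pos[of ?c r] pos[of ?c s] k by (simp add: mult_less_0_iff)
  \<comment> \<open>Far enough to the right that expansion forces
    \<open>F b \<ge> 1\<close>.\<close>
  define b where "b = ?c + 1 - F ?c"
  have cb: "?c < b" using \<open>F ?c < 0\<close> by (simp add: b_def)
  have "F b > 0" using expanding[of ?c b] cb by (simp add: b_def)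
  then have "?P b > 0" using P[of b] pos[of b r] pos[of b s] cb k by simp
  then obtain z where "z > ?c" "?P z = 0"
    using poly_IVT_pos[OF cb Pc] by blast
  \<comment> \<open>Between two distinct zeros \<open>F\<close> would have to grow by at least their
    distance.\<close>
  moreover have "z' = z" if "z' > ?c \<and> ?P z' = 0" for z'
    using that calculation zero[of z] zero[of z'] expanding[of z z'] expanding[of z' z]
    by (cases z z' rule: linorder_cases) auto
  ultimately show ?thesis by blast
qed

text \<open>Strictness comes from \<open>- \<mu> * cheb r * cheb s\<close>, since
  \<open>cheb k\<close> is zero at the endpoint.\<close>

lemma cheb_trans_pos:
  assumes "\<mu> < 0" "k \<ge> r + 1" "y \<ge> cos (pi / real (Suc k))"
  shows "poly (cheb_trans \<mu> r k) y > 0"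
proof -
  obtain s where k: "k = Suc (r + s)" using assms(2) by (metis Suc_eq_plus1 le_Suc_ex add_Suc)
  have "poly (cheb k) y \<ge> 0"
    using cheb_pos[of k k y] cheb_root[of k] assms k
    by (cases "y = cos (pi / real (Suc k))") auto
  moreover have "poly (cheb r) y > 0" "poly (cheb s) y > 0"
    using cheb_pos[of k r y] cheb_pos[of k s y] assms k by auto
  then have "\<mu> * (poly (cheb r) y * poly (cheb s) y) < 0"
    using assms(1) by (simp add: mult_neg_pos)
  ultimately show ?thesis
    using cheb_trans_conv_cheb[of \<mu> r s] k by simp
qed

lemma sgn_cheb_trans:
  assumes "k \<ge> r + 1"
  shows "sgn (poly (cheb_trans \<mu> r k) (cos (pi / real (Suc k)))) = - sgn \<mu>"
proof -
  let ?c = "cos (pi / real (Suc k))"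
  obtain s where k: "k = Suc (r + s)" using assms by (metis Suc_eq_plus1 le_Suc_ex add_Suc)
  have "poly (cheb_trans \<mu> r k) ?c = - (\<mu> * (poly (cheb r) ?c * poly (cheb s) ?c))"
    using cheb_trans_conv_cheb[of \<mu> r s] cheb_root[of k] k by simp
  moreover have "poly (cheb r) ?c > 0" "poly (cheb s) ?c > 0"
    using cheb_pos[of k r ?c] cheb_pos[of k s ?c] k by auto
  ultimately show ?thesis by (simp add: sgn_mult)
qed

section \<open>Assembly of the claims by reflection\<close>

theorem proposition5p6:
  fixes r k :: nat and \<mu> \<xi>min \<xi>max :: real
  assumes "k \<ge> r + 1"
    and "\<xi>min = Min (zeros (cheb k))"
    and "\<xi>max = Max (zeros (cheb k))"
  shows
    "sgn (poly (cheb_trans \<mu> r k) \<xi>max) = - sgn \<mu>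
     \<and> sgn (poly (cheb_trans \<mu> r k) \<xi>min) = (-1) ^ k * sgn \<mu>
     \<and> (\<mu> > 0 \<longrightarrow>
          (\<exists>i. 1 \<le> i \<and> i \<le> k \<and> nth_zero (cheb_trans \<mu> r k) i > \<xi>max
               \<and> poly (cheb_trans \<mu> r k) (nth_zero (cheb_trans \<mu> r k) i) = 0)
        \<and> odd (card {x \<in> zeros (cheb_trans \<mu> r k). x > \<xi>max})
        \<and> (\<forall>x::real. x \<le> \<xi>min \<longrightarrow> (-1) ^ k * poly (cheb_trans \<mu> r k) x > 0)
        \<and> \<not> (\<exists>x \<in> zeros (cheb_trans \<mu> r k). x < \<xi>min))
     \<and> (\<mu> < 0 \<longrightarrow>
          (\<forall>y::real. y \<ge> \<xi>max \<longrightarrow> poly (cheb_trans \<mu> r k) y > 0)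
        \<and> \<not> (\<exists>x \<in> zeros (cheb_trans \<mu> r k). x > \<xi>max)
        \<and> (\<exists>i. 1 \<le> i \<and> i \<le> k \<and> nth_zero (cheb_trans \<mu> r k) i < \<xi>min
               \<and> poly (cheb_trans \<mu> r k) (nth_zero (cheb_trans \<mu> r k) i) = 0)
        \<and> odd (card {x \<in> zeros (cheb_trans \<mu> r k). x < \<xi>min}))"
proof -
  let ?c = "cos (pi / real (Suc k))"
  let ?p = "cheb_trans \<mu> r k"
  have k: "k \<ge> 1" using assms(1) by simp
  have mx: "\<xi>max = ?c" and mn: "\<xi>min = - ?c"
    using assms Max_zeros_cheb[OF k] Min_zeros_cheb[OF k] by auto
  have reflect: "poly ?p x = (-1) ^ k * poly (cheb_trans (- \<mu>) r k) (- x)" for x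
    using cheb_trans_minus[of \<mu> r k "- x"] by simp
  have nth: "\<exists>i. 1 \<le> i \<and> i \<le> k \<and> Q (nth_zero ?p i) \<and> poly ?p (nth_zero ?p i) = 0"
    if "Q z" "poly ?p z = 0" for Q z
    using nth_zero_exists[OF cheb_trans_nonzero that(2)] that
    by (metis degree_cheb_trans)
  have card1: "odd (card {x \<in> zeros ?p. Q x})" if "\<exists>!z. Q z \<and> poly ?p z = 0" for Q
  proof -
    from that obtain z where "{x \<in> zeros ?p. Q x} = {z}" by (auto simp: zeros_def)
    then show ?thesis by simp
  qed
  have upper_pos: "\<exists>!z. z > \<xi>max \<and> poly ?p z = 0" if "\<mu> > 0"
    using cheb_trans_root_gt[OF that assms(1)] mx by simp
  have lower_pos: "(-1) ^ k * poly ?p x > 0" if "\<mu> > 0" "x \<le> \<xi>min" for x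
    \<comment> \<open>Reflection gives \<open>- \<mu> < 0\<close> and \<open>- x \<ge> ?c\<close>;
      the two factors \<open>(-1) ^ k\<close> cancel.\<close>
    using cheb_trans_pos[of "- \<mu>" r k "- x"] that assms(1) mn
    by (simp add: reflect flip: mult.assoc power_mult_distrib)
  have upper_neg: "poly ?p y > 0" if "\<mu> < 0" "y \<ge> \<xi>max" for y
    using cheb_trans_pos[of \<mu> r k y] that assms(1) mx by simp
  have lower_neg: "\<exists>!z. z < \<xi>min \<and> poly ?p z = 0" if "\<mu> < 0"
  proof -
    \<comment> \<open>Negation maps these zeros bijectively onto the zeros of \<open>?p\<close>
      below \<open>\<xi>min\<close>.\<close>
    have "\<exists>!z. z > ?c \<and> poly (cheb_trans (- \<mu>) r k) z = 0"
      using cheb_trans_root_gt[OF _ assms(1)] that by simp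
    then obtain z where z: "z > ?c" "poly (cheb_trans (- \<mu>) r k) z = 0"
      and uniq: "\<And>w. w > ?c \<Longrightarrow> poly (cheb_trans (- \<mu>) r k) w = 0 \<Longrightarrow> w = z"
      by blast
    show ?thesis
    proof (intro ex1I[of _ "- z"] conjI)
      show "w = - z" if "w < \<xi>min \<and> poly ?p w = 0" for w
        using uniq[of "- w"] that mn by (simp add: reflect)
    qed (use z mn in \<open>simp_all add: reflect\<close>)
  qed
  have "sgn (poly ?p \<xi>max) = - sgn \<mu>"
    using sgn_cheb_trans[OF assms(1)] mx by simp
  moreover have "sgn (poly ?p \<xi>min) = (-1) ^ k * sgn \<mu>"
    using sgn_cheb_trans[OF assms(1), of "- \<mu>"] mn by (simp add: reflect sgn_mult power_sgn)
  moreover have "\<not> (\<exists>x \<in> zeros ?p. x < \<xi>min)" if "\<mu> > 0"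
    using lower_pos[OF that less_imp_le] by (fastforce simp: zeros_def)
  moreover have "\<not> (\<exists>x \<in> zeros ?p. x > \<xi>max)" if "\<mu> < 0"
    using upper_neg[OF that less_imp_le] by (fastforce simp: zeros_def)
  moreover have "\<exists>i. 1 \<le> i \<and> i \<le> k \<and> nth_zero ?p i > \<xi>max \<and> poly ?p (nth_zero ?p i) = 0"
    if "\<mu> > 0"
    using upper_pos[OF that] nth[of "\<lambda>z. z > \<xi>max"] by blast
  moreover have "\<exists>i. 1 \<le> i \<and> i \<le> k \<and> nth_zero ?p i < \<xi>min \<and> poly ?p (nth_zero ?p i) = 0"
    if "\<mu> < 0"
    using lower_neg[OF that] nth[of "\<lambda>z. z < \<xi>min"] by blast
  ultimately show ?thesis
    using card1[of "\<lambda>z. z > \<xi>max"] card1[of "\<lambda>z. z < \<xi>min"]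
      upper_pos lower_neg lower_pos upper_neg by blast
qed

end
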